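(* Let $k$ and $p$ be even positive integers with $p\le k-2$ and $p$ dividing $k$, and let $0\le a\le \frac1{\cos\left(\frac{p\pi}{2k}\right)}$. Then for $b=\frac pk\tan\left(\frac{p\pi}{2k}\right)$ the trigonometric polynomial $$g_1(\theta)=1-a\cos(p\theta)+b\cos(k\theta)$$ satisfies $g_1(\theta)\ge0$ for all $\theta$. In particular, if in addition the plane of the $w$ variables has dimension $1$ (so that $w=w_1$), then by adding another harmonic term $\epsilon\sin(k\theta)$, for a suitable real $\epsilon$, one can achieve $g_1(w_1)\ge c_1|w_1|^k$ for some $c_1>0$.
   Context: Here $w_1=|w_1|e^{i\theta}\in\mathbb C$ and the trigonometric polynomial $g_1(\theta)=1-a\cos(p\theta)+b\cos(k\theta)$ is identified with the function homogeneous of degree $k$ given by $g_1(w_1)=|w_1|^k g_1(\theta)$, i.e. $|w_1|^k-a|w_1|^{k-p}\mathrm{Re}\,w_1^p+b\,\mathrm{Re}\,w_1^k$, the added harmonic term being $\epsilon\,\mathrm{Im}\,w_1^k$.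
   Formalization: The strict bound g_1(w_1) ≥ c_1|w_1|^k is claimed only for a < 1/cos(pπ/(2k)); at a = 1/cos(pπ/(2k)) it is false for every ε, since at θ = ±π/(2k) the corrected polynomial equals ±ε. Nonnegativity is kept for all a in the stated range. *)

theory Defs
  imports "HOL-Analysis.Analysis"
begin

definition g1 :: "nat \<Rightarrow> nat \<Rightarrow> real \<Rightarrow> real \<Rightarrow> real \<Rightarrow> real" where
  "g1 k p a b \<theta> = 1 - a * cos (real p * \<theta>) + b * cos (real k * \<theta>)"

definition g1_hom :: "nat \<Rightarrow> nat \<Rightarrow> real \<Rightarrow> real \<Rightarrow> complex \<Rightarrow> real" where
  "g1_hom k p a b w = cmod w ^ k - a * cmod w ^ (k - p) * Re (w ^ p) + b * Re (w ^ k)"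

text \<open>The two functions are identified through $w = r e^{i\theta}$; the harmonic term
  $\epsilon \sin(k\theta)$ then corresponds to $\epsilon\,\mathrm{Im}\, w^k$.\<close>

lemma g1_hom_polar:
  assumes "p \<le> k" and "0 \<le> r"
  shows "g1_hom k p a b (rcis r \<theta>) = r ^ k * g1 k p a b \<theta>"
proof -
  have "r ^ (k - p) * r ^ p = r ^ k"
    using assms(1) by (simp flip: power_add)
  then show ?thesis
    using assms(2) by (simp add: g1_hom_def g1_def DeMoivre2 algebra_simps)
qed

lemma Im_power_polar: "\<epsilon> * Im (rcis r \<theta> ^ k) = r ^ k * (\<epsilon> * sin (real k * \<theta>))"
  by (simp add: DeMoivre2)

text \<open>At the endpoint $a = 1/\cos(p\pi/(2k))$ the strict lower bound cannot be achieved: the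
  corrected function takes the values $\epsilon$ and $-\epsilon$ at $\theta = \pm\pi/(2k)$, for
  every $b$. This is why the strict bound is only claimed for $a < 1/\cos(p\pi/(2k))$.\<close>

lemma no_strict_bound_at_endpoint:
  fixes k p :: nat and b :: real
  assumes "0 < p" and "p \<le> k - 2"
  shows "\<not> (\<exists>\<epsilon> c\<^sub>1. c\<^sub>1 > 0 \<and>
    (\<forall>w. g1_hom k p (1 / cos (real p * pi / (2 * real k))) b w + \<epsilon> * Im (w ^ k)
            \<ge> c\<^sub>1 * cmod w ^ k))"
proof
  define \<phi> where "\<phi> = pi / (2 * real k)"
  define a where "a = 1 / cos (real p * pi / (2 * real k))"
  assume "\<exists>\<epsilon> c\<^sub>1. c\<^sub>1 > 0 \<and>
    (\<forall>w. g1_hom k p (1 / cos (real p * pi / (2 * real k))) b w + \<epsilon> * Im (w ^ k)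
            \<ge> c\<^sub>1 * cmod w ^ k)"
  then obtain \<epsilon> c where c: "c > 0"
    and le: "\<And>w. c * cmod w ^ k \<le> g1_hom k p a b w + \<epsilon> * Im (w ^ k)"
    unfolding a_def by blast
  have pk: "0 < k" "p < k" using assms by linarith+
  have "0 < real p * pi / (2 * real k)" "real p * pi / (2 * real k) < pi / 2"
    using assms(1) pk by (simp_all add: field_simps)
  then have "cos (real p * pi / (2 * real k)) > 0"
    by (intro cos_gt_zero)
  then have a: "a * cos (real p * \<phi>) = 1"
    by (simp add: a_def \<phi>_def)
  have k: "real k * \<phi> = pi / 2" using pk by (simp add: \<phi>_def)
  have pol: "c \<le> g1 k p a b \<theta> + \<epsilon> * sin (real k * \<theta>)" for \<theta>
    using le[of "rcis 1 \<theta>"] pk by (simp add: g1_hom_polar Im_power_polar del: rcis_def)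
  have "c \<le> \<epsilon>" using pol[of \<phi>] a k by (simp add: g1_def)
  moreover have "c \<le> - \<epsilon>" using pol[of "- \<phi>"] a k by (simp add: g1_def)
  ultimately show False using c by linarith
qed

end

theory Submission imports Defs begin

text \<open>
  Put \<open>n = k / p\<close>, an integer at least \<open>2\<close>, \<open>\<phi> = p \<theta>\<close> and \<open>\<alpha> = \<pi> / (2 n)\<close>; then
  \<open>g1\<close> becomes \<open>1 - a cos \<phi> + (tan \<alpha> / n) cos (n \<phi>)\<close>. The extreme case is
  \<open>a = 1 / cos \<alpha>\<close>. Multiplied by \<open>cos \<alpha>\<close>, the polynomial is then
  \<open>H \<phi> = cos \<alpha> - cos \<phi> + (sin \<alpha> / n) cos (n \<phi>)\<close>, with
  \<open>H' \<phi> = sin \<phi> - sin \<alpha> sin (n \<phi>)\<close>. The coefficient \<open>b\<close> is chosen so that \<open>H\<close> has a double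
  zero at \<open>\<alpha>\<close>, where \<open>cos (n \<alpha>) = 0\<close> and \<open>sin (n \<alpha>) = 1\<close>. On \<open>[0, \<alpha>]\<close> the derivative is at
  most \<open>0\<close>, because \<open>sin (n \<phi>) / sin \<phi>\<close> decreases to \<open>1 / sin \<alpha>\<close> there
  (\<open>sin_multiple_ratio_antimono\<close>); on \<open>[\<alpha>, \<pi>/2]\<close> it is at least \<open>0\<close>, because
  \<open>sin \<phi> \<ge> sin \<alpha>\<close>. So \<open>H \<ge> 0\<close> on \<open>[0, \<pi>/2]\<close> (\<open>extremal_nonneg_first_quadrant\<close>). By symmetry
  this covers all angles with \<open>cos \<phi> \<ge> 0\<close>, and for \<open>cos \<phi> \<le> 0\<close> the term \<open>cos \<alpha>\<close> alone
  dominates (\<open>extremal_nonneg\<close>).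

  A smaller \<open>a\<close> gives a convex combination of the extreme polynomial and of
  \<open>1 + b cos (n \<phi>) \<ge> 1 - b > 0\<close>, with weights \<open>a cos \<alpha>\<close> and \<open>1 - a cos \<alpha>\<close>. Hence the polynomial
  is at least \<open>(1 - a cos \<alpha>) (1 - b)\<close> (\<open>two_term_lower_bound\<close>). This gives nonnegativity, and for
  \<open>a < 1 / cos \<alpha>\<close> it is a positive constant, so the harmonic correction may even be taken
  with \<open>\<epsilon> = 0\<close>.
\<close>

text \<open>The quotient \<open>sin (n x) / sin x\<close> is a sum of cosines \<open>cos (j x)\<close> with \<open>\<bar>j\<bar> < n\<close>, all
  decreasing in \<open>x\<close> as long as \<open>n x \<le> \<pi>/2\<close>. The induction adds these cosines through the
  addition theorem and stays free of denominators.\<close>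

lemma sin_multiple_ratio_antimono:
  fixes x y :: real
  assumes "0 \<le> x" "x \<le> y" "real n * y \<le> pi / 2"
  shows "sin x * sin (real n * y) \<le> sin (real n * x) * sin y"
  using assms(3)
proof (induction n)
  case 0
  then show ?case by simp
next
  case (Suc n)
  have split: "real (Suc n) * z = real n * z + z" for z by (simp add: algebra_simps)
  have y0: "0 \<le> y" using assms by linarith
  have ny0: "0 \<le> real n * y" using y0 by simp
  have y2: "y \<le> pi / 2" and ny: "real n * y \<le> pi / 2"
    using Suc.prems ny0 y0 by (simp_all only: split)
  have nxy: "real n * x \<le> real n * y" "0 \<le> real n * x"
    using assms by (simp_all add: mult_left_mono)
  have IH: "sin x * sin (real n * y) \<le> sin (real n * x) * sin y"
    using Suc.IH ny by blast
  have c: "0 \<le> cos y" "cos y \<le> cos x"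
    using y0 y2 assms by (auto intro!: cos_ge_zero cos_monotone_0_pi_le)
  have cn: "cos (real n * y) \<le> cos (real n * x)"
    using nxy ny by (intro cos_monotone_0_pi_le) auto
  have s: "0 \<le> sin x" "0 \<le> sin y"
    using assms y0 y2 by (auto intro!: sin_ge_zero)
  have sn: "0 \<le> sin (real n * x)"
    using nxy ny by (intro sin_ge_zero) auto
  have "sin x * sin (real n * y) * cos y \<le> sin (real n * x) * sin y * cos y"
    by (rule mult_right_mono[OF IH c(1)])
  also have "\<dots> \<le> sin (real n * x) * sin y * cos x"
    using c(2) s sn by (intro mult_left_mono) auto
  finally have "sin x * sin (real n * y) * cos y \<le> sin (real n * x) * sin y * cos x" .
  moreover have "sin x * sin y * cos (real n * y) \<le> sin x * sin y * cos (real n * x)"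
    using cn s by (intro mult_left_mono) auto
  ultimately show ?case
    unfolding split sin_add by (simp add: algebra_simps)
qed

lemma quarter_period_bounds:
  fixes \<alpha> :: real
  assumes "real n * \<alpha> = pi / 2" "0 < m" "m \<le> n"
  shows "0 < \<alpha>" "\<alpha> \<le> pi / 2 / real m"
proof -
  have eq: "\<alpha> = pi / 2 / real n" using assms by (simp add: field_simps)
  show "0 < \<alpha>" unfolding eq using assms by (intro divide_pos_pos) auto
  show "\<alpha> \<le> pi / 2 / real m" unfolding eq using assms by (intro divide_left_mono) auto
qed

lemma extremal_nonneg_first_quadrant:
  fixes \<alpha> \<phi> :: real
  assumes n: "0 < n" and \<alpha>: "real n * \<alpha> = pi / 2" and \<phi>: "0 \<le> \<phi>" "\<phi> \<le> pi / 2"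
  shows "0 \<le> cos \<alpha> - cos \<phi> + sin \<alpha> / real n * cos (real n * \<phi>)"
proof -
  define H where "H x = cos \<alpha> - cos x + sin \<alpha> / real n * cos (real n * x)" for x
  have deriv: "(H has_real_derivative sin x - sin \<alpha> * sin (real n * x)) (at x)" for x
    unfolding H_def using n by (auto intro!: derivative_eq_intros)
  have \<alpha>0: "0 \<le> \<alpha>" "\<alpha> \<le> pi / 2" using quarter_period_bounds[OF \<alpha>, of 1] n by simp_all
  have s\<alpha>: "0 \<le> sin \<alpha>" using \<alpha>0 by (intro sin_ge_zero) auto
  have H\<alpha>: "H \<alpha> = 0" by (simp add: H_def \<alpha>)
  have "0 \<le> H \<phi>"
  proof (cases "\<phi> \<le> \<alpha>")
    case True
    have "H \<alpha> \<le> H \<phi>"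
    proof (rule DERIV_nonpos_imp_nonincreasing[OF True])
      fix x assume "\<phi> \<le> x" "x \<le> \<alpha>"
      then have "sin x \<le> sin \<alpha> * sin (real n * x)"
        using sin_multiple_ratio_antimono[of x \<alpha> n] \<phi> unfolding \<alpha>
        by (simp add: mult.commute[of "sin \<alpha>"])
      with deriv[of x] show "\<exists>y. (H has_real_derivative y) (at x) \<and> y \<le> 0" by force
    qed
    then show ?thesis by (simp add: H\<alpha>)
  next
    case False
    have "H \<alpha> \<le> H \<phi>"
    proof (rule DERIV_nonneg_imp_nondecreasing[of \<alpha> \<phi> H])
      show "\<alpha> \<le> \<phi>" using False by simp
    next
      fix x assume x: "\<alpha> \<le> x" "x \<le> \<phi>"
      have "sin \<alpha> * sin (real n * x) \<le> sin \<alpha> * 1"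
        using s\<alpha> by (intro mult_left_mono) auto
      also have "\<dots> \<le> sin x"
        using x \<alpha>0 \<phi> by (auto intro!: sin_monotone_2pi_le)
      finally show "\<exists>y. (H has_real_derivative y) (at x) \<and> 0 \<le> y" using deriv[of x] by force
    qed
    then show ?thesis by (simp add: H\<alpha>)
  qed
  then show ?thesis by (simp add: H_def)
qed

text \<open>\<open>cos (n x)\<close> is a (Chebyshev) polynomial in \<open>cos x\<close>. This lets an arbitrary angle be
  replaced by the one in \<open>[0, \<pi>]\<close> with the same cosine.\<close>

lemma cos_multiple_cong:
  fixes x y :: real
  assumes "cos x = cos y"
  shows "cos (real n * x) = cos (real n * y)"
proof (induction n rule: induct_nat_012)
  case (ge2 n)
  have "cos (real (Suc (Suc n)) * z) = 2 * cos z * cos (real (Suc n) * z) - cos (real n * z)"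
    for z :: real
  proof -
    have "real (Suc (Suc n)) * z = real (Suc n) * z + z" "real n * z = real (Suc n) * z - z"
      by (simp_all add: algebra_simps)
    then show ?thesis by (simp only: cos_add cos_diff) (simp add: algebra_simps)
  qed
  with ge2 assms show ?case by simp
qed (use assms in auto)

text \<open>For \<open>n \<ge> 2\<close> the angle \<open>\<alpha>\<close> is at most \<open>\<pi>/4\<close>, so \<open>cos \<alpha> \<ge> sin \<alpha>\<close> settles the angles with
  \<open>cos \<phi> < 0\<close>.\<close>

lemma extremal_nonneg:
  fixes \<alpha> \<phi> :: real
  assumes n: "2 \<le> n" and \<alpha>: "real n * \<alpha> = pi / 2"
  shows "0 \<le> cos \<alpha> - cos \<phi> + sin \<alpha> / real n * cos (real n * \<phi>)"
proof (cases "0 \<le> cos \<phi>")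
  case True
  define \<psi> where "\<psi> = arccos (cos \<phi>)"
  have "\<psi> \<le> pi / 2" unfolding \<psi>_def using True by (intro arccos_le_pi2) auto
  moreover have "0 \<le> \<psi>" "cos \<psi> = cos \<phi>" by (simp_all add: \<psi>_def arccos_lbound)
  ultimately show ?thesis
    using extremal_nonneg_first_quadrant[of n \<alpha> \<psi>] cos_multiple_cong[of \<psi> \<phi> n] n \<alpha> by simp
next
  case False
  have \<alpha>0: "0 \<le> \<alpha>" "\<alpha> \<le> pi / 4" using quarter_period_bounds[OF \<alpha>, of 2] n by simp_all
  have s\<alpha>: "0 \<le> sin \<alpha>" using \<alpha>0 by (intro sin_ge_zero) auto
  have "sin \<alpha> \<le> sin (pi / 2 - \<alpha>)" using \<alpha>0 by (intro sin_monotone_2pi_le) auto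
  then have "sin \<alpha> \<le> cos \<alpha>" by (simp add: sin_diff)
  moreover have "sin \<alpha> / real n \<le> sin \<alpha> / 1" using n s\<alpha> by (intro divide_left_mono) auto
  moreover have "sin \<alpha> / real n * (- 1) \<le> sin \<alpha> / real n * cos (real n * \<phi>)"
    using s\<alpha> by (intro mult_left_mono) auto
  ultimately show ?thesis using False by simp
qed

lemma two_term_lower_bound:
  fixes \<alpha> \<phi> a b :: real
  assumes n: "2 \<le> n" and \<alpha>: "real n * \<alpha> = pi / 2"
    and a: "0 \<le> a" "a * cos \<alpha> \<le> 1" and b: "b = tan \<alpha> / real n" "0 \<le> b"
  shows "(1 - a * cos \<alpha>) * (1 - b) \<le> 1 - a * cos \<phi> + b * cos (real n * \<phi>)"
proof -
  have "0 < \<alpha>" "\<alpha> \<le> pi / 4" using quarter_period_bounds[OF \<alpha>, of 2] n by simp_all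
  then have c\<alpha>: "cos \<alpha> > 0" by (intro cos_gt_zero_pi) auto
  have "sin \<alpha> / real n = b * cos \<alpha>" using b c\<alpha> by (simp add: tan_def)
  then have "0 \<le> cos \<alpha> - cos \<phi> + b * cos \<alpha> * cos (real n * \<phi>)"
    using extremal_nonneg[OF n \<alpha>, of \<phi>] by simp
  then have "0 \<le> a * (cos \<alpha> - cos \<phi> + b * cos \<alpha> * cos (real n * \<phi>))"
    using a by (intro mult_nonneg_nonneg)
  moreover have "b * (- 1) \<le> b * cos (real n * \<phi>)"
    using b by (intro mult_left_mono) auto
  then have "(1 - a * cos \<alpha>) * (1 - b) \<le> (1 - a * cos \<alpha>) * (1 + b * cos (real n * \<phi>))"
    using a by (intro mult_left_mono) auto
  ultimately show ?thesis by (simp add: algebra_simps)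
qed

theorem proposition4p2:
  fixes k p :: nat and a b :: real
  assumes "even k" and "even p" and "0 < k" and "0 < p" and "p \<le> k - 2" and "p dvd k"
    and "0 \<le> a" and "a \<le> 1 / cos (real p * pi / (2 * real k))"
    and "b = real p / real k * tan (real p * pi / (2 * real k))"
  shows "(\<forall>\<theta>. g1 k p a b \<theta> \<ge> 0) \<and>
    (a < 1 / cos (real p * pi / (2 * real k)) \<longrightarrow>
      (\<exists>\<epsilon> c\<^sub>1. c\<^sub>1 > 0 \<and>
        (\<forall>w\<^sub>1. g1_hom k p a b w\<^sub>1 + \<epsilon> * Im (w\<^sub>1 ^ k) \<ge> c\<^sub>1 * cmod w\<^sub>1 ^ k)))"
proof -
  obtain n where kn: "k = p * n" using assms(6) by blast
  have pk: "p < k" using assms by linarith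
  have n: "2 \<le> n"
  proof (rule ccontr)
    assume "\<not> 2 \<le> n"
    then have "n = 0 \<or> n = 1" by auto
    with kn pk show False by auto
  qed
  define \<alpha> where "\<alpha> = real p * pi / (2 * real k)"
  have \<alpha>: "real n * \<alpha> = pi / 2" using assms(4) n by (simp add: \<alpha>_def kn)
  have \<alpha>0: "0 < \<alpha>" "\<alpha> \<le> pi / 4" using quarter_period_bounds[OF \<alpha>, of 2] n by simp_all
  have c\<alpha>: "cos \<alpha> > 0" using \<alpha>0 by (intro cos_gt_zero_pi) auto
  have t\<alpha>: "0 \<le> tan \<alpha>" using \<alpha>0 by (intro less_imp_le tan_gt_zero) auto
  have "tan \<alpha> \<le> tan (pi / 4)"
    using \<alpha>0 by (intro tan_mono_le) auto
  then have t1: "tan \<alpha> \<le> 1" by (simp add: tan_45)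
  have b: "b = tan \<alpha> / real n"
    using assms(4,9) unfolding \<alpha>_def[symmetric] by (simp add: kn)
  have b0: "0 \<le> b" using t\<alpha> by (simp add: b)
  have b1: "b < 1" using t1 n by (simp add: b)
  have a: "a * cos \<alpha> \<le> 1"
    using assms(8) c\<alpha> unfolding \<alpha>_def[symmetric] by (simp add: field_simps)
  define c where "c = (1 - a * cos \<alpha>) * (1 - b)"
  have bound: "c \<le> g1 k p a b \<theta>" for \<theta>
    using two_term_lower_bound[OF n \<alpha> assms(7) a b b0, of "real p * \<theta>"]
    by (simp add: c_def g1_def kn mult_ac)
  have "0 \<le> c" using a b1 by (simp add: c_def)
  then have "\<forall>\<theta>. 0 \<le> g1 k p a b \<theta>" using bound order_trans by blast
  moreover have "\<exists>\<epsilon> c\<^sub>1. c\<^sub>1 > 0 \<and>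
        (\<forall>w\<^sub>1. g1_hom k p a b w\<^sub>1 + \<epsilon> * Im (w\<^sub>1 ^ k) \<ge> c\<^sub>1 * cmod w\<^sub>1 ^ k)"
    if "a < 1 / cos (real p * pi / (2 * real k))"
  proof -
    have "a * cos \<alpha> < 1"
      using that c\<alpha> unfolding \<alpha>_def[symmetric] by (simp add: field_simps)
    then have c0: "0 < c" using b1 by (simp add: c_def)
    have "c * cmod w ^ k \<le> g1_hom k p a b w" for w
    proof -
      have "g1_hom k p a b w = cmod w ^ k * g1 k p a b (Arg w)"
        using g1_hom_polar[of p k "cmod w" a b "Arg w"] pk by (simp add: rcis_cmod_Arg)
      then show ?thesis
        using mult_left_mono[OF bound[of "Arg w"], of "cmod w ^ k"] by (simp add: mult.commute)
    qed
    then have "\<forall>w. g1_hom k p a b w + 0 * Im (w ^ k) \<ge> c * cmod w ^ k" by simp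
    with c0 show ?thesis by blast
  qed
  ultimately show ?thesis by blast
qed

end
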